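(* Let $n\geqslant 1$ be an integer and let $E(\mathcal{PIO}_n)$ be the set of all idempotents of the monoid $\mathcal{PIO}_n$. Then $$\lvert E(\mathcal{PIO}_n)\rvert=1+\frac{n(n+1)(n+2)(n+3)}{24}.$$
   Context: $\Omega_n=\{1,\ldots,n\}$ with its natural order. A partial transformation of $\Omega_n$ is a map $\alpha$ from a subset $\operatorname{Dom}(\alpha)\subseteq\Omega_n$ (possibly empty) into $\Omega_n$, with image $\operatorname{Im}(\alpha)$. Maps are written on the right and composed from left to right: $x(\alpha\beta)=(x\alpha)\beta$, with $\operatorname{Dom}(\alpha\beta)=\{x\in\operatorname{Dom}(\alpha)\mid x\alpha\in\operatorname{Dom}(\beta)\}$. $\alpha$ is order-preserving if $x\leqslant y$ implies $x\alpha\leqslant y\alpha$ for all $x,y\in\operatorname{Dom}(\alpha)$. A subset $I\subseteq\Omega_n$ (possibly empty) is an interval if for all $x,y,z\in\Omega_n$, $x\leqslant y\leqslant z$ and $x,z\in I$ imply $y\in I$. $\mathcal{PIO}_n$ is the monoid, under composition, of all order-preserving partial transformations $\alpha$ of $\Omega_n$ such that $\operatorname{Dom}(\alpha)$ and $\operatorname{Im}(\alpha)$ are both intervals of $\Omega_n$ (it includes the empty transformation). An element $\alpha$ is idempotent if $\alpha^2=\alpha$. *)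

theory Defs
  imports Complex_Main "HOL-Algebra.Group"
begin

definition Omega :: "nat \<Rightarrow> nat set"
  where "Omega n = {1..n}"

definition partial_transformation :: "nat \<Rightarrow> (nat \<rightharpoonup> nat) \<Rightarrow> bool"
  where "partial_transformation n \<alpha> \<longleftrightarrow> dom \<alpha> \<subseteq> Omega n \<and> ran \<alpha> \<subseteq> Omega n"

definition order_preserving :: "(nat \<rightharpoonup> nat) \<Rightarrow> bool"
  where "order_preserving \<alpha> \<longleftrightarrow>
    (\<forall>x\<in>dom \<alpha>. \<forall>y\<in>dom \<alpha>. x \<le> y \<longrightarrow> the (\<alpha> x) \<le> the (\<alpha> y))"

definition interval_of :: "nat \<Rightarrow> nat set \<Rightarrow> bool"
  where "interval_of n I \<longleftrightarrow> I \<subseteq> Omega n \<and>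
    (\<forall>x\<in>Omega n. \<forall>y\<in>Omega n. \<forall>z\<in>Omega n. x \<le> y \<and> y \<le> z \<and> x \<in> I \<and> z \<in> I \<longrightarrow> y \<in> I)"

(* Maps act on the right, so the product of \<alpha> and \<beta> applies \<alpha> first. *)
definition PIO :: "nat \<Rightarrow> (nat \<rightharpoonup> nat) monoid"
  where "PIO n =
    \<lparr>carrier = {\<alpha>. partial_transformation n \<alpha> \<and> order_preserving \<alpha> \<and>
                   interval_of n (dom \<alpha>) \<and> interval_of n (ran \<alpha>)},
     mult = (\<lambda>\<alpha> \<beta>. \<beta> \<circ>\<^sub>m \<alpha>),
     one = (\<lambda>x. if x \<in> Omega n then Some x else None)\<rparr>"

definition idempotents :: "('a, 'b) monoid_scheme \<Rightarrow> 'a set"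
  where "idempotents M = {e \<in> carrier M. e \<otimes>\<^bsub>M\<^esub> e = e}"

lemma PIO_mult_closed:
  assumes "\<alpha> \<in> carrier (PIO n)" "\<beta> \<in> carrier (PIO n)"
  shows "\<beta> \<circ>\<^sub>m \<alpha> \<in> carrier (PIO n)"
proof -
  have a: "dom \<alpha> \<subseteq> Omega n" "ran \<alpha> \<subseteq> Omega n" "interval_of n (dom \<alpha>)" "interval_of n (ran \<alpha>)"
    and b: "dom \<beta> \<subseteq> Omega n" "ran \<beta> \<subseteq> Omega n" "interval_of n (dom \<beta>)" "interval_of n (ran \<beta>)"
    using assms by (auto simp: PIO_def partial_transformation_def)
  have opa: "u \<le> v" if "\<alpha> x = Some u" "\<alpha> y = Some v" "x \<le> y" for x y u v
    using assms(1) that by (force simp: PIO_def order_preserving_def)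
  have opb: "u \<le> v" if "\<beta> x = Some u" "\<beta> y = Some v" "x \<le> y" for x y u v
    using assms(2) that by (force simp: PIO_def order_preserving_def)
  let ?c = "\<beta> \<circ>\<^sub>m \<alpha>"
  have c: "?c x = Some w \<longleftrightarrow> (\<exists>u. \<alpha> x = Some u \<and> \<beta> u = Some w)" for x w
    by (simp add: map_comp_Some_iff)
  have conv: "y \<in> I" if "interval_of n I" "x \<in> I" "z \<in> I" "x \<le> y" "y \<le> z" for I x y z
  proof -
    have "x \<in> Omega n" "z \<in> Omega n"
      using that by (auto simp: interval_of_def)
    moreover from this have "y \<in> Omega n"
      using that by (auto simp: Omega_def)
    ultimately show ?thesis
      using that unfolding interval_of_def by blast
  qed
  have sub: "dom ?c \<subseteq> Omega n" "ran ?c \<subseteq> Omega n"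
  proof -
    show "dom ?c \<subseteq> Omega n"
    proof
      fix x assume "x \<in> dom ?c"
      then obtain w where "?c x = Some w" by blast
      then show "x \<in> Omega n" using c a(1) by blast
    qed
    show "ran ?c \<subseteq> Omega n"
    proof
      fix w assume "w \<in> ran ?c"
      then obtain x where "?c x = Some w" unfolding ran_def by blast
      then show "w \<in> Omega n" using c b(2) by (meson ranI subsetD)
    qed
  qed
  have op: "order_preserving ?c"
    unfolding order_preserving_def
  proof (intro ballI impI)
    fix x y assume "x \<in> dom ?c" "y \<in> dom ?c" and le: "x \<le> y"
    then obtain v w where vw: "?c x = Some v" "?c y = Some w" by blast
    then obtain s t where "\<alpha> x = Some s" "\<beta> s = Some v" "\<alpha> y = Some t" "\<beta> t = Some w"
      using c by meson
    then have "v \<le> w" using opa opb le by meson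
    then show "the (?c x) \<le> the (?c y)" using vw by simp
  qed
  have d: "y \<in> dom ?c" if xz: "x \<in> dom ?c" "z \<in> dom ?c" "x \<le> y" "y \<le> z" for x y z
  proof -
    obtain u u' where u: "\<alpha> x = Some u" "u \<in> dom \<beta>" "\<alpha> z = Some u'" "u' \<in> dom \<beta>"
    proof -
      obtain w w' where "?c x = Some w" "?c z = Some w'" using xz(1,2) by blast
      then show thesis using c that by (meson domI)
    qed
    have "y \<in> dom \<alpha>"
      using conv[OF a(3), of x z y] u xz by blast
    then obtain v where v: "\<alpha> y = Some v" by blast
    have "v \<in> dom \<beta>"
      using conv[OF b(3) u(2,4)] opa[OF u(1) v xz(3)] opa[OF v u(3) xz(4)] by blast
    then obtain w where "\<beta> v = Some w" by blast
    then have "?c y = Some w" using v c by blast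
    then show ?thesis by (rule domI)
  qed
  have r: "v \<in> ran ?c" if uw: "u \<in> ran ?c" "w \<in> ran ?c" "u \<le> v" "v \<le> w" for u v w
  proof -
    obtain x s where s: "\<alpha> x = Some s" "\<beta> s = Some u"
      using uw(1) c unfolding ran_def by blast
    obtain y t where t: "\<alpha> y = Some t" "\<beta> t = Some w"
      using uw(2) c unfolding ran_def by blast
    have "v \<in> ran \<beta>"
      using conv[OF b(4), of u w v] s t uw by (meson ranI)
    then obtain k where k: "\<beta> k = Some v" by (auto simp: ran_def)
    consider "k < s" | "t < k" | "s \<le> k" "k \<le> t" by linarith
    then show ?thesis
    proof cases
      case 1
      then have "v = u" using opb[OF k s(2)] uw by simp
      then show ?thesis using uw by simp
    next
      case 2
      then have "v = w" using opb[OF t(2) k] uw by simp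
      then show ?thesis using uw by simp
    next
      case 3
      then have "k \<in> ran \<alpha>"
        using conv[OF a(4), of s t k] s t by (meson ranI)
      then obtain m where "\<alpha> m = Some k" unfolding ran_def by blast
      then have "?c m = Some v" using k c by blast
      then show ?thesis by (rule ranI)
    qed
  qed
  have "interval_of n (dom ?c)" "interval_of n (ran ?c)"
    unfolding interval_of_def using sub d r by meson+
  then show ?thesis
    using sub op by (simp add: PIO_def partial_transformation_def)
qed

lemma monoid_PIO: "monoid (PIO n)"
proof (rule monoidI)
  fix x y assume "x \<in> carrier (PIO n)" "y \<in> carrier (PIO n)"
  then show "x \<otimes>\<^bsub>PIO n\<^esub> y \<in> carrier (PIO n)"
    using PIO_mult_closed[of x n y] by (simp add: PIO_def)
next
  have *: "dom (\<lambda>x. if x \<in> Omega n then Some x else None) = Omega n"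
    "ran (\<lambda>x. if x \<in> Omega n then Some x else None) = Omega n"
    by (auto simp: ran_def dom_def split: if_splits)
  show "\<one>\<^bsub>PIO n\<^esub> \<in> carrier (PIO n)"
    by (simp add: PIO_def partial_transformation_def interval_of_def order_preserving_def *)
next
  fix x y z
  show "x \<otimes>\<^bsub>PIO n\<^esub> y \<otimes>\<^bsub>PIO n\<^esub> z = x \<otimes>\<^bsub>PIO n\<^esub> (y \<otimes>\<^bsub>PIO n\<^esub> z)"
    by (auto simp: PIO_def map_comp_def fun_eq_iff split: option.splits)
next
  fix x assume x: "x \<in> carrier (PIO n)"
  then have sub: "dom x \<subseteq> Omega n" "ran x \<subseteq> Omega n"
    by (auto simp: PIO_def partial_transformation_def)
  have out: "x i = None" if "i \<notin> Omega n" for i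
    using sub(1) that by (meson domIff subsetD)
  show "\<one>\<^bsub>PIO n\<^esub> \<otimes>\<^bsub>PIO n\<^esub> x = x"
    by (auto simp: PIO_def map_comp_def fun_eq_iff out)
  have "j \<in> Omega n" if "x i = Some j" for i j
    using sub(2) that by (meson ranI subsetD)
  then show "x \<otimes>\<^bsub>PIO n\<^esub> \<one>\<^bsub>PIO n\<^esub> = x"
    by (auto simp: PIO_def map_comp_def fun_eq_iff split: option.splits)
qed

end

theory Submission
  imports Defs
begin

text \<open>
  An idempotent fixes every point of its image, so its image is contained in its domain. If the
  domain of a nonempty idempotent of \<open>PIO n\<close> is the interval from \<open>a\<close> to \<open>d\<close> and its image the
  interval from \<open>b\<close> to \<open>c\<close>, then \<open>a \<le> b \<le> c \<le> d\<close>; points of the domain below \<open>b\<close> must go to \<open>b\<close>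
  and points above \<open>c\<close> must go to \<open>c\<close>, because the map is order-preserving, fixes \<open>b\<close> and \<open>c\<close>, and
  has no values outside their interval. The map is therefore the retraction that clamps
  \<open>{a..d}\<close> onto \<open>{b..c}\<close>, and each such quadruple does give an idempotent
  (\<open>idempotents_PIO\<close>). Domain and image determine the quadruple, so the nonempty idempotents
  correspond to the weakly increasing quadruples from \<open>{1..n}\<close>. There are \<open>(n + 3) choose 4\<close> of
  these (\<open>card_increasing_quadruples\<close>), and the empty map accounts for the summand 1.
\<close>

text \<open>The coordinates are listed from the largest to the smallest, so that each one bounds the
  range of the next and the cardinality is an iterated sum.\<close>

definition increasing_quadruples :: "nat \<Rightarrow> (nat \<times> nat \<times> nat \<times> nat) set"
  where "increasing_quadruples n = (SIGMA d:{1..n}. SIGMA c:{1..d}. SIGMA b:{1..c}. {1..b})"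

definition clamp :: "nat \<Rightarrow> nat \<Rightarrow> nat \<Rightarrow> nat \<Rightarrow> nat \<rightharpoonup> nat"
  where "clamp a b c d = (\<lambda>x. if a \<le> x \<and> x \<le> d then Some (max b (min x c)) else None)"

lemma mem_increasing_quadruples:
  "(d, c, b, a) \<in> increasing_quadruples n \<longleftrightarrow> 1 \<le> a \<and> a \<le> b \<and> b \<le> c \<and> c \<le> d \<and> d \<le> n"
  by (auto simp: increasing_quadruples_def)

text \<open>The hockey-stick identity, shifted so that each use turns one summation over a coordinate
  of a quadruple into the next binomial coefficient.\<close>

lemma sum_shifted_binomial:
  "(\<Sum>k=1..n. (k + r) choose Suc r) = (n + Suc r) choose Suc (Suc r)"
  by (induction n) (simp_all add: binomial_eq_0)

lemma card_increasing_quadruples: "card (increasing_quadruples n) = (n + 3) choose 4"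
proof -
  have "card (increasing_quadruples n) = (\<Sum>d=1..n. \<Sum>c=1..d. \<Sum>b=1..c. b)"
    by (simp add: increasing_quadruples_def)
  also have "(\<lambda>c. \<Sum>b=1..c. b) = (\<lambda>c. (c + 1) choose 2)"
    using sum_shifted_binomial[of 0] by (simp add: numeral_2_eq_2)
  also have "(\<lambda>d. \<Sum>c=1..d. (c + 1) choose 2) = (\<lambda>d. (d + 2) choose 3)"
    using sum_shifted_binomial[of 1] by (simp add: numeral_eq_Suc)
  also have "(\<Sum>d=1..n. (d + 2) choose 3) = (n + 3) choose 4"
    using sum_shifted_binomial[of 2 n] by (simp add: numeral_eq_Suc)
  finally show ?thesis .
qed

lemma binomial_4_closed_form:
  "24 * ((n + 3) choose 4) = n * (n + 1) * (n + 2) * (n + 3)"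
proof -
  have "4 * ((n + 3) choose 4) = (n + 3) * ((n + 2) choose 3)"
    using Suc_times_binomial[of 3 "n + 2"] by (simp add: numeral_eq_Suc)
  moreover have "3 * ((n + 2) choose 3) = (n + 2) * ((n + 1) choose 2)"
    using Suc_times_binomial[of 2 "n + 1"] by (simp add: numeral_eq_Suc)
  moreover have "2 * ((n + 1) choose 2) = (n + 1) * n"
    using Suc_times_binomial[of 1 n] by (simp add: numeral_eq_Suc)
  ultimately show ?thesis
    by algebra
qed

lemma nonempty_interval_of_eq_atLeastAtMost:
  assumes "interval_of n I" "I \<noteq> {}"
  obtains a b where "I = {a..b}" "1 \<le> a" "a \<le> b" "b \<le> n"
proof -
  have sub: "I \<subseteq> {1..n}"
    using assms(1) by (simp add: interval_of_def Omega_def)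
  then have fin: "finite I"
    using finite_subset by blast
  have ends: "Min I \<in> I" "Max I \<in> I"
    using fin assms(2) by simp_all
  have "y \<in> I" if "Min I \<le> y" "y \<le> Max I" for y
  proof -
    have "y \<in> Omega n" "Min I \<in> Omega n" "Max I \<in> Omega n"
      using that ends sub by (auto simp: Omega_def)
    then show ?thesis
      using assms(1) that ends unfolding interval_of_def by blast
  qed
  then have "{Min I..Max I} \<subseteq> I"
    by (meson atLeastAtMost_iff subsetI)
  moreover have "I \<subseteq> {Min I..Max I}"
    using Min_le[OF fin] Max_ge[OF fin] by (meson atLeastAtMost_iff subsetI)
  moreover have "1 \<le> Min I" "Max I \<le> n"
    using ends sub by (meson atLeastAtMost_iff subsetD)+
  moreover have "Min I \<le> Max I"
    using ends(2) by (rule Min_le[OF fin])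
  ultimately show thesis
    using that[of "Min I" "Max I"] by (meson subset_antisym)
qed

lemma interval_of_atLeastAtMost: "1 \<le> a \<Longrightarrow> b \<le> n \<Longrightarrow> interval_of n {a..b}"
  by (auto simp: interval_of_def Omega_def)

lemma dom_clamp: "dom (clamp a b c d) = {a..d}"
  by (auto simp: clamp_def split: if_splits)

lemma ran_clamp:
  assumes "a \<le> b" "b \<le> c" "c \<le> d"
  shows "ran (clamp a b c d) = {b..c}"
proof
  show "ran (clamp a b c d) \<subseteq> {b..c}"
    using assms by (auto simp: ran_def clamp_def split: if_splits)
  show "{b..c} \<subseteq> ran (clamp a b c d)"
  proof
    fix y assume "y \<in> {b..c}"
    then have "clamp a b c d y = Some y"
      using assms by (auto simp: clamp_def)
    then show "y \<in> ran (clamp a b c d)"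
      by (rule ranI)
  qed
qed

lemma clamp_in_idempotents:
  assumes "1 \<le> a" "a \<le> b" "b \<le> c" "c \<le> d" "d \<le> n"
  shows "clamp a b c d \<in> idempotents (PIO n)"
proof -
  have "order_preserving (clamp a b c d)"
    by (auto simp: order_preserving_def dom_clamp) (auto simp: clamp_def)
  moreover have "partial_transformation n (clamp a b c d)"
    using assms by (auto simp: partial_transformation_def dom_clamp ran_clamp Omega_def)
  moreover have "interval_of n (dom (clamp a b c d))" "interval_of n (ran (clamp a b c d))"
    using assms by (simp_all add: dom_clamp ran_clamp interval_of_atLeastAtMost)
  moreover have "clamp a b c d \<circ>\<^sub>m clamp a b c d = clamp a b c d"
    using assms by (auto simp: map_comp_def clamp_def fun_eq_iff)
  ultimately show ?thesis
    by (simp add: idempotents_def PIO_def)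
qed

lemma empty_in_idempotents: "Map.empty \<in> idempotents (PIO n)"
  by (simp add: idempotents_def PIO_def partial_transformation_def order_preserving_def
      interval_of_def)

lemma map_comp_idempotent_fixes_ran:
  assumes "e \<circ>\<^sub>m e = e" "y \<in> ran e"
  shows "e y = Some y"
proof -
  obtain x where x: "e x = Some y"
    using assms(2) by (auto simp: ran_def)
  then have "(e \<circ>\<^sub>m e) x = e y"
    by (simp add: map_comp_def)
  then show ?thesis
    using assms(1) x by simp
qed

text \<open>Since \<open>b\<close> and \<open>c\<close> are fixed, monotonicity squeezes the value at a point outside
  \<open>{b..c}\<close> onto the nearer endpoint, the only value left in the image.\<close>

lemma nonempty_idempotent_eq_clamp:
  assumes "e \<in> idempotents (PIO n)" "e \<noteq> Map.empty"
  obtains a b c d where "e = clamp a b c d" "1 \<le> a" "a \<le> b" "b \<le> c" "c \<le> d" "d \<le> n"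
proof -
  have idem: "e \<circ>\<^sub>m e = e" and op: "order_preserving e"
    and ints: "interval_of n (dom e)" "interval_of n (ran e)"
    using assms(1) by (auto simp: idempotents_def PIO_def)
  have "dom e \<noteq> {}" "ran e \<noteq> {}"
    using assms(2) by (auto simp: ran_def fun_eq_iff)
  obtain a d where ad: "dom e = {a..d}" "1 \<le> a" "a \<le> d" "d \<le> n"
    using nonempty_interval_of_eq_atLeastAtMost[OF ints(1) \<open>dom e \<noteq> {}\<close>] .
  obtain b c where bc: "ran e = {b..c}" "b \<le> c"
    using nonempty_interval_of_eq_atLeastAtMost[OF ints(2) \<open>ran e \<noteq> {}\<close>] by metis
  have fixed: "e y = Some y" if "b \<le> y" "y \<le> c" for y
    using map_comp_idempotent_fixes_ran[OF idem] bc that by simp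
  have "b \<in> dom e" "c \<in> dom e"
    using fixed[of b] fixed[of c] bc(2) by auto
  then have le: "a \<le> b" "c \<le> d"
    using ad by auto
  have mono: "u \<le> v" if "e x = Some u" "e y = Some v" "x \<le> y" for x y u v
    using op that by (force simp: order_preserving_def)
  have "e x = clamp a b c d x" for x
  proof (cases "x \<in> dom e")
    case True
    then obtain y where y: "e x = Some y"
      by blast
    then have "y \<in> ran e"
      by (rule ranI)
    then have "b \<le> y" "y \<le> c"
      using bc by auto
    moreover have "y \<le> b" if "x \<le> b"
      using mono[OF y fixed[of b]] that bc(2) by simp
    moreover have "c \<le> y" if "c \<le> x"
      using mono[OF fixed[of c] y] that bc(2) by simp
    moreover have "y = x" if "b \<le> x" "x \<le> c"
      using fixed[OF that] y by simp
    ultimately have "y = max b (min x c)"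
      using bc(2) by linarith
    then show ?thesis
      using True y ad(1) by (auto simp: clamp_def)
  next
    case False
    then show ?thesis
      using ad(1) dom_clamp[of a b c d] by (metis domIff)
  qed
  then show thesis
    using that[of a b c d] le bc(2) ad by blast
qed

lemma idempotents_PIO:
  "idempotents (PIO n) =
    insert Map.empty ((\<lambda>(d, c, b, a). clamp a b c d) ` increasing_quadruples n)"
proof
  show "idempotents (PIO n) \<subseteq>
      insert Map.empty ((\<lambda>(d, c, b, a). clamp a b c d) ` increasing_quadruples n)"
  proof
    fix e assume e: "e \<in> idempotents (PIO n)"
    show "e \<in> insert Map.empty ((\<lambda>(d, c, b, a). clamp a b c d) ` increasing_quadruples n)"
    proof (cases "e = Map.empty")
      case False
      obtain a b c d where "e = clamp a b c d" "1 \<le> a" "a \<le> b" "b \<le> c" "c \<le> d" "d \<le> n"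
        using nonempty_idempotent_eq_clamp[OF e False] .
      then have "(d, c, b, a) \<in> increasing_quadruples n"
        by (simp add: mem_increasing_quadruples)
      from imageI[OF this, of "\<lambda>(d, c, b, a). clamp a b c d"] show ?thesis
        by (simp add: \<open>e = clamp a b c d\<close>)
    qed simp
  qed
  show "insert Map.empty ((\<lambda>(d, c, b, a). clamp a b c d) ` increasing_quadruples n)
      \<subseteq> idempotents (PIO n)"
    using empty_in_idempotents clamp_in_idempotents
    by (auto simp: mem_increasing_quadruples)
qed

text \<open>The endpoints of the domain and of the image recover the quadruple.\<close>

lemma inj_on_clamp: "inj_on (\<lambda>(d, c, b, a). clamp a b c d) (increasing_quadruples n)"
proof (rule inj_onI)
  fix p q
  assume p: "p \<in> increasing_quadruples n" and q: "q \<in> increasing_quadruples n"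
    and eq: "(\<lambda>(d, c, b, a). clamp a b c d) p = (\<lambda>(d, c, b, a). clamp a b c d) q"
  obtain d c b a where p_def: "p = (d, c, b, a)"
    by (cases p)
  obtain d' c' b' a' where q_def: "q = (d', c', b', a')"
    by (cases q)
  have le: "a \<le> b" "b \<le> c" "c \<le> d" "a' \<le> b'" "b' \<le> c'" "c' \<le> d'"
    using p q unfolding p_def q_def mem_increasing_quadruples by blast+
  have eq': "clamp a b c d = clamp a' b' c' d'"
    using eq by (simp only: p_def q_def prod.case)
  have "{a..d} = {a'..d'}"
    using arg_cong[OF eq', of dom] by (simp only: dom_clamp)
  moreover have "{b..c} = {b'..c'}"
    using arg_cong[OF eq', of ran] by (simp only: ran_clamp le)
  ultimately have "a = a' \<and> d = d' \<and> b = b' \<and> c = c'"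
    using le unfolding Icc_eq_Icc by linarith
  then show "p = q"
    by (simp add: p_def q_def)
qed

theorem proposition5:
  fixes n :: nat
  assumes "n \<ge> 1"
  shows "real (card (idempotents (PIO n))) =
    1 + real n * (real n + 1) * (real n + 2) * (real n + 3) / 24"
proof -
  let ?clamps = "(\<lambda>(d, c, b, a). clamp a b c d) ` increasing_quadruples n"
  have "finite ?clamps"
    by (simp add: increasing_quadruples_def)
  moreover have "Map.empty \<notin> ?clamps"
  proof
    assume "Map.empty \<in> ?clamps"
    then obtain a b c d
      where "(d, c, b, a) \<in> increasing_quadruples n" "clamp a b c d = Map.empty"
      by auto
    then show False
      using dom_clamp[of a b c d] by (simp add: mem_increasing_quadruples)
  qed
  ultimately have "card (idempotents (PIO n)) = 1 + ((n + 3) choose 4)"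
    by (simp add: idempotents_PIO card_image[OF inj_on_clamp] card_increasing_quadruples)
  moreover have "24 * real ((n + 3) choose 4) = real n * (real n + 1) * (real n + 2) * (real n + 3)"
    using arg_cong[OF binomial_4_closed_form[of n], of real]
    by (simp only: of_nat_mult of_nat_add of_nat_1 of_nat_numeral)
  ultimately show ?thesis
    by (simp only: of_nat_add of_nat_1)
qed

end
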